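(* Let $\Omega\subset\mathbb{R}^N$ ($N\ge 2$) be a bounded smooth domain, $0<s<1<p<\infty$, $\alpha>0$, and $\omega\in L^1(\Omega)\setminus\{0\}$ with $\omega\ge0$. For each $n\in\mathbb{N}$ let $\omega_n:=\min\{\omega,n\}$ and let $u_n\in W_0^{s,p}(\Omega)$ be the unique function, positive in $\Omega$, such that $$\langle(-\Delta_p)^s u_n,\varphi\rangle=\int_\Omega\frac{\omega_n\varphi}{(u_n+\frac1n)^\alpha}\,dx\quad\text{for all }\varphi\in W_0^{s,p}(\Omega).$$ Then the sequences $\{u_n\}_{n\in\mathbb{N}}$ and $\{[u_n]_{s,p}\}_{n\in\mathbb{N}}\subset(0,\infty)$ are nondecreasing, that is, $$u_n\le u_{n+1}\ \text{ in }\Omega\qquad\text{and}\qquad[u_n]_{s,p}\le[u_{n+1}]_{s,p},\qquad\text{for all }n\in\mathbb{N}.$$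
   Context: Gagliardo semi-norm: $[u]_{s,p}:=\left(\iint_{\mathbb{R}^{2N}}\frac{|u(x)-u(y)|^p}{|x-y|^{N+sp}}\,dx\,dy\right)^{1/p}$. $W_0^{s,p}(\Omega)$ is the completion of $C_c^\infty(\Omega)$ with respect to $([u]_{s,p}^p+\|u\|_p^p)^{1/p}$; equivalently $W_0^{s,p}(\Omega)=\{u\in L^p(\mathbb{R}^N):[u]_{s,p}<\infty,\ u=0 \text{ in }\mathbb{R}^N\setminus\Omega\}$, normed by $[\cdot]_{s,p}$. Pairing: $\langle(-\Delta_p)^s u,v\rangle:=\iint_{\mathbb{R}^{2N}}\frac{|u(x)-u(y)|^{p-2}(u(x)-u(y))(v(x)-v(y))}{|x-y|^{N+sp}}\,dx\,dy$ for $u,v\in W_0^{s,p}(\Omega)$. The functions $u_n$ exist, are unique, and are continuous on $\overline\Omega$ and strictly positive in $\Omega$. *)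

theory Defs
  imports "HOL-Analysis.Analysis"
begin

fun C_k :: "nat \<Rightarrow> ('a::euclidean_space \<Rightarrow> real) \<Rightarrow> bool" where
  "C_k 0 f = continuous_on UNIV f"
| "C_k (Suc k) f =
     ((\<forall>x. f differentiable (at x)) \<and>
      (\<forall>v. C_k k (\<lambda>x. frechet_derivative f (at x) v)))"

definition C_infinity :: "('a::euclidean_space \<Rightarrow> real) \<Rightarrow> bool" where
  "C_infinity f \<longleftrightarrow> (\<forall>k. C_k k f)"

text \<open>Near each of its boundary points a smooth domain is the strict epigraph, in the
  direction of some unit vector \<open>e\<close>, of a smooth function of the coordinates orthogonal
  to \<open>e\<close>.  The vector \<open>x - (x \<bullet> e) *\<^sub>R e\<close> is the orthogonal projection of \<open>x\<close> to the
  hyperplane \<open>e\<^sup>\<bottom>\<close>; a smooth function on that hyperplane is represented by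
  a smooth \<open>\<gamma>\<close> on the whole space.\<close>

definition smooth_boundary :: "'a::euclidean_space set \<Rightarrow> bool" where
  "smooth_boundary \<Omega> \<longleftrightarrow>
     (\<forall>x0\<in>frontier \<Omega>. \<exists>r>0. \<exists>e \<gamma>. norm e = 1 \<and> C_infinity \<gamma> \<and>
        \<Omega> \<inter> ball x0 r = {x \<in> ball x0 r. \<gamma> (x - (x \<bullet> e) *\<^sub>R e) < x \<bullet> e})"

definition bounded_smooth_domain :: "'a::euclidean_space set \<Rightarrow> bool" where
  "bounded_smooth_domain \<Omega> \<longleftrightarrow>
     open \<Omega> \<and> connected \<Omega> \<and> \<Omega> \<noteq> {} \<and> bounded \<Omega> \<and> smooth_boundary \<Omega>"

text \<open>Elements of the Lebesgue and Sobolev spaces are handled through Borel measurable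
  representatives.  On the diagonal \<open>x = y\<close>, a null set, the kernels below have
  denominator \<open>0\<close> and hence value \<open>0\<close>.\<close>

definition gagliardo_energy :: "real \<Rightarrow> real \<Rightarrow> ('a::euclidean_space \<Rightarrow> real) \<Rightarrow> ennreal" where
  "gagliardo_energy s p u =
     (\<integral>\<^sup>+(x, y). ennreal (\<bar>u x - u y\<bar> powr p / norm (x - y) powr (real DIM('a) + s * p))
        \<partial>(lborel \<Otimes>\<^sub>M lborel))"

text \<open>The \<open>p\<close>-th root in \<open>[0, \<infinity>]\<close> of the energy.\<close>

definition gagliardo :: "real \<Rightarrow> real \<Rightarrow> ('a::euclidean_space \<Rightarrow> real) \<Rightarrow> ennreal" where
  "gagliardo s p u =
     (if gagliardo_energy s p u = \<infinity> then \<infinity>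
      else ennreal (enn2real (gagliardo_energy s p u) powr (1 / p)))"

text \<open>The description of the completion of \<open>C\<^sub>c\<^sup>\<infinity>(\<Omega>)\<close> as the functions in \<open>L\<^sup>p\<close> of the whole
  space with finite seminorm that vanish outside \<open>\<Omega>\<close>; the two agree for bounded smooth
  domains.\<close>

definition W0 :: "real \<Rightarrow> real \<Rightarrow> 'a::euclidean_space set \<Rightarrow> ('a \<Rightarrow> real) set" where
  "W0 s p \<Omega> =
     {u. u \<in> borel_measurable lborel \<and> integrable lborel (\<lambda>x. \<bar>u x\<bar> powr p) \<and>
         gagliardo s p u < \<infinity> \<and> (AE x in lborel. x \<notin> \<Omega> \<longrightarrow> u x = 0)}"

text \<open>For \<open>u\<close>, \<open>v\<close> in \<^term>\<open>W0 s p \<Omega>\<close> with \<open>p > 1\<close> the integrand is integrable, by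
  Hoelder's inequality.  Where \<open>u x = u y\<close> it is \<open>0\<close>, also for \<open>p < 2\<close>.\<close>

definition frac_p_laplace_pairing ::
    "real \<Rightarrow> real \<Rightarrow> ('a::euclidean_space \<Rightarrow> real) \<Rightarrow> ('a \<Rightarrow> real) \<Rightarrow> real" where
  "frac_p_laplace_pairing s p u v =
     (\<integral>(x, y). \<bar>u x - u y\<bar> powr (p - 2) * (u x - u y) * (v x - v y)
                  / norm (x - y) powr (real DIM('a) + s * p)
        \<partial>(lborel \<Otimes>\<^sub>M lborel))"

end

theory Submission
  imports Defs
begin

text \<open>Testing the equations for \<open>u\<^sub>n\<close> and \<open>u\<^sub>n\<^sub>+\<^sub>1\<close> with \<open>\<phi> = (u\<^sub>n - u\<^sub>n\<^sub>+\<^sub>1)\<^sup>+\<close> and subtracting, the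
  right-hand sides contribute something nonpositive, since \<open>\<omega>\<^sub>n \<le> \<omega>\<^sub>n\<^sub>+\<^sub>1\<close> and
  \<open>u\<^sub>n + 1/n > u\<^sub>n\<^sub>+\<^sub>1 + 1/(n+1)\<close> wherever \<open>\<phi> > 0\<close>. On the left, \<open>J(t) = \<bar>t\<bar>\<^sup>p\<^sup>-\<^sup>2 t\<close> is strictly
  increasing and the increments of \<open>\<phi>\<close> have the sign of those of \<open>u\<^sub>n - u\<^sub>n\<^sub>+\<^sub>1\<close>, so the integrand is
  nonnegative and vanishes only where \<open>\<phi>(x) = \<phi>(y)\<close>. Hence \<open>\<phi>\<close> is constant a.e., and the constant
  is \<open>0\<close> because \<open>\<phi>\<close> vanishes off \<open>\<Omega>\<close>.

  For the seminorms, test the equation for \<open>u\<^sub>n\<close> with \<open>u\<^sub>n\<^sub>+\<^sub>1 - u\<^sub>n \<ge> 0\<close>: this gives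
  \<open>[u\<^sub>n]\<^sup>p \<le> \<langle>(-\<Delta>\<^sub>p)\<^sup>s u\<^sub>n, u\<^sub>n\<^sub>+\<^sub>1\<rangle>\<close>, and Young's inequality bounds the right-hand side by
  \<open>(1 - 1/p) [u\<^sub>n]\<^sup>p + [u\<^sub>n\<^sub>+\<^sub>1]\<^sup>p / p\<close>.\<close>

section \<open>The function \<open>J(t) = |t|^(p-2) t\<close> and its pointwise inequalities\<close>

definition signed_powr :: "real \<Rightarrow> real \<Rightarrow> real" where
  "signed_powr p t = \<bar>t\<bar> powr (p - 2) * t"

lemma signed_powr_nonneg: "0 \<le> t \<Longrightarrow> signed_powr p t = t powr (p - 1)"
  using powr_add[of t "p - 2" 1] by (cases "t = 0") (auto simp: signed_powr_def)

lemma signed_powr_minus: "signed_powr p (- t) = - signed_powr p t"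
  by (simp add: signed_powr_def)

lemma abs_signed_powr: "\<bar>signed_powr p t\<bar> = \<bar>t\<bar> powr (p - 1)"
  using signed_powr_nonneg[of "\<bar>t\<bar>" p] by (simp add: signed_powr_def abs_mult)

lemma signed_powr_mult_self: "signed_powr p t * t = \<bar>t\<bar> powr p"
proof (cases "t = 0")
  case False
  have "signed_powr p t * t = \<bar>t\<bar> powr (p - 2) * \<bar>t\<bar> powr 2"
    using False by (simp add: signed_powr_def power2_eq_square)
  also have "\<dots> = \<bar>t\<bar> powr p"
    by (subst powr_add[symmetric]) simp
  finally show ?thesis .
qed (simp add: signed_powr_def)

text \<open>On the half-line \<open>0 \<le> t\<close> the function is \<open>t powr (p - 1)\<close>
  with positive exponent. Oddness carries this over to the negative half-line, and the value at 0
  separates arguments of opposite sign.\<close>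

lemma signed_powr_strict_mono:
  assumes "1 < p" "a < b"
  shows "signed_powr p a < signed_powr p b"
proof -
  have pos: "signed_powr p x < signed_powr p y" if "0 \<le> x" "x < y" for x y
    using that assms by (simp add: signed_powr_nonneg powr_less_mono2)
  consider "0 \<le> a" | "b \<le> 0" | "a < 0" "0 < b" by linarith
  then show ?thesis
  proof cases
    case 1 then show ?thesis using pos assms by simp
  next
    case 2 then show ?thesis using pos[of "- b" "- a"] assms by (simp add: signed_powr_minus)
  next
    case 3
    then have "signed_powr p 0 < signed_powr p (- a)" "signed_powr p 0 < signed_powr p b"
      by (auto intro: pos)
    then show ?thesis by (simp add: signed_powr_minus signed_powr_nonneg)
  qed
qed

text \<open>Young's inequality with the conjugate exponent \<open>q = p / (p - 1)\<close>, chosen so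
  that \<open>|signed_powr p a| powr q = |a| powr p\<close>. The weight \<open>1 - 1 / p < 1\<close>
  is what later allows the first term to be absorbed.\<close>

lemma signed_powr_young:
  assumes "1 < p"
  shows "\<bar>signed_powr p a * b\<bar> \<le> (1 - 1 / p) * \<bar>a\<bar> powr p + \<bar>b\<bar> powr p / p"
proof -
  define q where "q = p / (p - 1)"
  have q: "q > 1" "1 / q + 1 / p = 1" "(p - 1) * q = p" "1 / q = 1 - 1 / p"
    using assms by (auto simp: q_def field_simps)
  have "\<bar>signed_powr p a\<bar> * \<bar>b\<bar> \<le> \<bar>signed_powr p a\<bar> powr q / q + \<bar>b\<bar> powr p / p"
    using q assms by (intro Youngs_inequality) auto
  also have "\<bar>signed_powr p a\<bar> powr q / q = (1 - 1 / p) * \<bar>a\<bar> powr p"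
    unfolding abs_signed_powr powr_powr q(3) by (simp flip: q(4))
  finally show ?thesis by (simp add: abs_mult)
qed

text \<open>The comparison of \<open>a - b\<close> with \<open>c - d\<close> is that of
  \<open>a - c\<close> with \<open>b - d\<close>, so both factors have compatible signs. The first
  factor vanishes only for \<open>a - b = c - d\<close>, and then the positive parts agree
  too.\<close>

lemma signed_powr_pos_part_monotone:
  fixes p a b c d :: real
  assumes "1 < p"
  defines "D \<equiv> (signed_powr p (a - b) - signed_powr p (c - d)) * (max 0 (a - c) - max 0 (b - d))"
  shows "0 \<le> D" and "D = 0 \<Longrightarrow> max 0 (a - c) = max 0 (b - d)"
proof -
  have "0 < D" if ne: "max 0 (a - c) \<noteq> max 0 (b - d)"
  proof (cases "a - b" "c - d" rule: linorder_cases)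
    case less
    then have "signed_powr p (a - b) < signed_powr p (c - d)" "max 0 (a - c) < max 0 (b - d)"
      using signed_powr_strict_mono assms ne by auto
    then show ?thesis by (simp add: D_def mult_neg_neg)
  next
    case equal
    then have "a - c = b - d" by simp
    then show ?thesis using ne by simp
  next
    case greater
    then have "signed_powr p (a - b) > signed_powr p (c - d)" "max 0 (a - c) > max 0 (b - d)"
      using signed_powr_strict_mono assms ne by auto
    then show ?thesis by (simp add: D_def)
  qed
  moreover have "D = 0" if "max 0 (a - c) = max 0 (b - d)"
    using that by (simp add: D_def)
  ultimately show "0 \<le> D" "D = 0 \<Longrightarrow> max 0 (a - c) = max 0 (b - d)"
    by (metis order.refl order.strict_implies_order, metis less_irrefl)
qed

lemma abs_powr_le_of_abs_le_add:
  fixes a b c p :: real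
  assumes "\<bar>c\<bar> \<le> \<bar>a\<bar> + \<bar>b\<bar>" "0 < p"
  shows "\<bar>c\<bar> powr p \<le> 2 powr p * (\<bar>a\<bar> powr p + \<bar>b\<bar> powr p)"
proof -
  have "\<bar>c\<bar> powr p \<le> (2 * max \<bar>a\<bar> \<bar>b\<bar>) powr p"
    using assms by (intro powr_mono2) auto
  also have "\<dots> = 2 powr p * max \<bar>a\<bar> \<bar>b\<bar> powr p"
    by (simp add: powr_mult)
  also have "\<dots> \<le> 2 powr p * (\<bar>a\<bar> powr p + \<bar>b\<bar> powr p)"
    by (intro mult_left_mono) (auto simp: max_def)
  finally show ?thesis .
qed

section \<open>Energy and pairing as integrals of densities on the product space\<close>

definition gagliardo_density :: "real \<Rightarrow> real \<Rightarrow> ('a::euclidean_space \<Rightarrow> real) \<Rightarrow> 'a \<times> 'a \<Rightarrow> real" where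
  "gagliardo_density s p u z =
     \<bar>u (fst z) - u (snd z)\<bar> powr p / norm (fst z - snd z) powr (real DIM('a) + s * p)"

definition pairing_density ::
    "real \<Rightarrow> real \<Rightarrow> ('a::euclidean_space \<Rightarrow> real) \<Rightarrow> ('a \<Rightarrow> real) \<Rightarrow> 'a \<times> 'a \<Rightarrow> real" where
  "pairing_density s p u v z =
     signed_powr p (u (fst z) - u (snd z)) * (v (fst z) - v (snd z))
       / norm (fst z - snd z) powr (real DIM('a) + s * p)"

lemma gagliardo_energy_alt:
  "gagliardo_energy s p u = (\<integral>\<^sup>+z. ennreal (gagliardo_density s p u z) \<partial>(lborel \<Otimes>\<^sub>M lborel))"
  by (simp add: gagliardo_energy_def gagliardo_density_def case_prod_unfold)

lemma frac_p_laplace_pairing_alt: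
  "frac_p_laplace_pairing s p u v = integral\<^sup>L (lborel \<Otimes>\<^sub>M lborel) (pairing_density s p u v)"
  by (simp add: frac_p_laplace_pairing_def pairing_density_def[abs_def] signed_powr_def case_prod_unfold)

lemma gagliardo_density_nonneg: "0 \<le> gagliardo_density s p u z"
  by (simp add: gagliardo_density_def)

lemma pairing_density_self: "pairing_density s p u u = gagliardo_density s p u"
  by (rule ext) (simp add: pairing_density_def gagliardo_density_def signed_powr_mult_self)

lemma norm_diff_powr_measurable [measurable]:
  "(\<lambda>z::'a::euclidean_space \<times> 'a. norm (fst z - snd z) powr r) \<in> borel_measurable (lborel \<Otimes>\<^sub>M lborel)"
proof -
  have [measurable]: "(fst :: 'a \<times> 'a \<Rightarrow> 'a) \<in> borel_measurable (lborel \<Otimes>\<^sub>M lborel)"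
    "(snd :: 'a \<times> 'a \<Rightarrow> 'a) \<in> borel_measurable (lborel \<Otimes>\<^sub>M lborel)"
    using measurable_fst[of "lborel :: 'a measure" "lborel :: 'a measure"]
      measurable_snd[of "lborel :: 'a measure" "lborel :: 'a measure"]
    by simp_all
  show ?thesis by measurable
qed

lemma increment_measurable [measurable]:
  assumes "u \<in> borel_measurable lborel"
  shows "(\<lambda>z. u (fst z) - u (snd z) :: real) \<in> borel_measurable (lborel \<Otimes>\<^sub>M lborel)"
  by (intro borel_measurable_diff measurable_compose[OF _ assms] measurable_fst measurable_snd)

lemma gagliardo_density_measurable [measurable]:
  "u \<in> borel_measurable lborel \<Longrightarrow>
   gagliardo_density s p u \<in> borel_measurable (lborel \<Otimes>\<^sub>M lborel)"
  unfolding gagliardo_density_def[abs_def]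
  by (intro borel_measurable_divide powr_real_measurable borel_measurable_abs
      increment_measurable norm_diff_powr_measurable) auto

lemma pairing_density_measurable [measurable]:
  "u \<in> borel_measurable lborel \<Longrightarrow> v \<in> borel_measurable lborel \<Longrightarrow>
   pairing_density s p u v \<in> borel_measurable (lborel \<Otimes>\<^sub>M lborel)"
  unfolding pairing_density_def[abs_def] signed_powr_def
  by (intro borel_measurable_divide borel_measurable_times powr_real_measurable
      borel_measurable_abs increment_measurable norm_diff_powr_measurable) auto

section \<open>The space \<open>W0\<close> in terms of integrable densities\<close>

lemma gagliardo_finite_iff: "gagliardo s p u < \<infinity> \<longleftrightarrow> gagliardo_energy s p u < \<infinity>"
  by (auto simp: gagliardo_def top.not_eq_extremum)

text \<open>The energy integrates a nonnegative measurable density, so its finiteness is Bochner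
  integrability. In this form membership can be proved by domination.\<close>

lemma W0_iff:
  "u \<in> W0 s p \<Omega> \<longleftrightarrow>
     u \<in> borel_measurable lborel \<and> integrable lborel (\<lambda>x. \<bar>u x\<bar> powr p) \<and>
     integrable (lborel \<Otimes>\<^sub>M lborel) (gagliardo_density s p u) \<and>
     (AE x in lborel. x \<notin> \<Omega> \<longrightarrow> u x = 0)"
  unfolding W0_def gagliardo_finite_iff gagliardo_energy_alt mem_Collect_eq
  by (auto simp: integrable_iff_bounded gagliardo_density_nonneg)

text \<open>Since \<open>signed_powr p t * t = |t| powr p\<close>, pairing \<open>u\<close> with
  itself gives \<open>[u]^p\<close>. Seminorms can therefore be compared through real-valued
  pairings.\<close>

lemma W0_energy_eq:
  assumes "u \<in> W0 s p \<Omega>"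
  shows "gagliardo_energy s p u = ennreal (frac_p_laplace_pairing s p u u)"
  using assms unfolding gagliardo_energy_alt frac_p_laplace_pairing_alt pairing_density_self
  by (intro nn_integral_eq_integral) (auto simp: W0_iff gagliardo_density_nonneg)

lemma frac_p_laplace_pairing_self_nonneg: "0 \<le> frac_p_laplace_pairing s p u u"
  unfolding frac_p_laplace_pairing_alt pairing_density_self
  by (intro integral_nonneg_AE) (simp add: gagliardo_density_nonneg)

lemma gagliardo_W0:
  assumes "u \<in> W0 s p \<Omega>"
  shows "gagliardo s p u = ennreal (frac_p_laplace_pairing s p u u powr (1 / p))"
  using W0_energy_eq[OF assms] frac_p_laplace_pairing_self_nonneg[of s p u]
  by (simp add: gagliardo_def)

text \<open>Supplies the two test functions, the positive part of \<open>u - v\<close> and the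
  difference of two solutions: both are controlled by \<open>u\<close> and \<open>v\<close> in
  values as well as in increments. The factor \<open>2 powr p\<close> is the cost of splitting the
  power of a sum.\<close>

lemma W0_dominated:
  assumes u: "u \<in> W0 s p \<Omega>" and v: "v \<in> W0 s p \<Omega>" and p: "0 < p"
    and [measurable]: "w \<in> borel_measurable lborel"
    and w: "\<And>x. \<bar>w x\<bar> \<le> \<bar>u x\<bar> + \<bar>v x\<bar>"
    and dw: "\<And>x y. \<bar>w x - w y\<bar> \<le> \<bar>u x - u y\<bar> + \<bar>v x - v y\<bar>"
  shows "w \<in> W0 s p \<Omega>"
proof -
  have U: "integrable lborel (\<lambda>x. \<bar>u x\<bar> powr p)" "integrable lborel (\<lambda>x. \<bar>v x\<bar> powr p)"
    "integrable (lborel \<Otimes>\<^sub>M lborel) (gagliardo_density s p u)"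
    "integrable (lborel \<Otimes>\<^sub>M lborel) (gagliardo_density s p v)"
    "AE x in lborel. x \<notin> \<Omega> \<longrightarrow> u x = 0" "AE x in lborel. x \<notin> \<Omega> \<longrightarrow> v x = 0"
    using u v by (auto simp: W0_iff)
  have 1: "integrable lborel (\<lambda>x. \<bar>w x\<bar> powr p)"
  proof (rule Bochner_Integration.integrable_bound)
    show "integrable lborel (\<lambda>x. 2 powr p * (\<bar>u x\<bar> powr p + \<bar>v x\<bar> powr p))"
      using U by auto
  qed (use abs_powr_le_of_abs_le_add[OF w p] in auto)
  have 2: "integrable (lborel \<Otimes>\<^sub>M lborel) (gagliardo_density s p w)"
  proof (rule Bochner_Integration.integrable_bound)
    show "integrable (lborel \<Otimes>\<^sub>M lborel)
        (\<lambda>z. 2 powr p * (gagliardo_density s p u z + gagliardo_density s p v z))"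
      using U by auto
    have "gagliardo_density s p w z
        \<le> 2 powr p * (gagliardo_density s p u z + gagliardo_density s p v z)" for z
      using abs_powr_le_of_abs_le_add[OF dw p, of "fst z" "snd z"]
      unfolding gagliardo_density_def
      by (simp add: divide_right_mono flip: add_divide_distrib)
    then show "AE z in lborel \<Otimes>\<^sub>M lborel. norm (gagliardo_density s p w z)
        \<le> norm (2 powr p * (gagliardo_density s p u z + gagliardo_density s p v z))"
      by (simp add: gagliardo_density_nonneg)
  qed measurable
  have 3: "AE x in lborel. x \<notin> \<Omega> \<longrightarrow> w x = 0"
    using U(5,6)
  proof eventually_elim
    case (elim x) then show ?case using w[of x] by auto
  qed
  show ?thesis unfolding W0_iff using 1 2 3 by auto
qed

section \<open>Integrability, Young's inequality and linearity for the pairing\<close>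

lemma pairing_density_young:
  assumes "1 < p"
  shows "\<bar>pairing_density s p u v z\<bar>
    \<le> (1 - 1 / p) * gagliardo_density s p u z + gagliardo_density s p v z / p"
  using divide_right_mono[OF signed_powr_young[OF assms,
        of "u (fst z) - u (snd z)" "v (fst z) - v (snd z)"], OF powr_ge_zero]
  unfolding pairing_density_def gagliardo_density_def
  by (simp add: add_divide_distrib mult.commute)

text \<open>Young's pointwise bound does the work of Hoelder's inequality. Integrability matters
  because the Bochner integral of a non-integrable function is 0 by default, and then it could be
  neither split nor compared.\<close>

lemma pairing_density_integrable:
  assumes "u \<in> W0 s p \<Omega>" "v \<in> W0 s p \<Omega>" "1 < p"
  shows "integrable (lborel \<Otimes>\<^sub>M lborel) (pairing_density s p u v)"
proof (rule Bochner_Integration.integrable_bound)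
  show "integrable (lborel \<Otimes>\<^sub>M lborel)
      (\<lambda>z. (1 - 1 / p) * gagliardo_density s p u z + gagliardo_density s p v z / p)"
    using assms by (auto simp: W0_iff)
  have "norm (pairing_density s p u v z)
      \<le> norm ((1 - 1 / p) * gagliardo_density s p u z + gagliardo_density s p v z / p)" for z
    using pairing_density_young[OF assms(3), of s u v z] by simp
  then show "AE z in lborel \<Otimes>\<^sub>M lborel. norm (pairing_density s p u v z)
      \<le> norm ((1 - 1 / p) * gagliardo_density s p u z + gagliardo_density s p v z / p)"
    by (intro AE_I2)
qed (use assms in \<open>auto simp: W0_iff\<close>)

lemma frac_p_laplace_pairing_young:
  assumes "u \<in> W0 s p \<Omega>" "v \<in> W0 s p \<Omega>" "1 < p"
  shows "frac_p_laplace_pairing s p u v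
    \<le> (1 - 1 / p) * frac_p_laplace_pairing s p u u + frac_p_laplace_pairing s p v v / p"
proof -
  have I: "integrable (lborel \<Otimes>\<^sub>M lborel) (gagliardo_density s p u)"
    "integrable (lborel \<Otimes>\<^sub>M lborel) (gagliardo_density s p v)"
    using assms by (auto simp: W0_iff)
  have "integral\<^sup>L (lborel \<Otimes>\<^sub>M lborel) (pairing_density s p u v)
      \<le> (\<integral>z. (1 - 1 / p) * gagliardo_density s p u z + gagliardo_density s p v z / p
            \<partial>(lborel \<Otimes>\<^sub>M lborel))"
    using I by (intro integral_mono pairing_density_integrable[OF assms]
        abs_le_D1[OF pairing_density_young] assms) auto
  then show ?thesis
    using I by (simp add: frac_p_laplace_pairing_alt pairing_density_self)
qed

lemma frac_p_laplace_pairing_diff: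
  assumes "u \<in> W0 s p \<Omega>" "v \<in> W0 s p \<Omega>" "w \<in> W0 s p \<Omega>" "1 < p"
  shows "frac_p_laplace_pairing s p u (\<lambda>x. v x - w x)
    = frac_p_laplace_pairing s p u v - frac_p_laplace_pairing s p u w"
proof -
  have "pairing_density s p u (\<lambda>x. v x - w x)
      = (\<lambda>z. pairing_density s p u v z - pairing_density s p u w z)"
    by (rule ext) (simp add: pairing_density_def algebra_simps flip: diff_divide_distrib)
  then show ?thesis
    using assms by (simp add: frac_p_laplace_pairing_alt pairing_density_integrable)
qed

section \<open>Consequences of almost everywhere statements\<close>

lemma AE_const_zero_of_bounded_support:
  fixes f :: "'a::euclidean_space \<Rightarrow> real"
  assumes eq: "AE z in lborel \<Otimes>\<^sub>M lborel. f (fst z) = f (snd z)"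
    and \<Omega>: "bounded \<Omega>" "\<Omega> \<in> sets lborel"
    and supp: "AE x in lborel. x \<notin> \<Omega> \<longrightarrow> f x = 0"
  shows "AE x in lborel. f x = 0"
proof -
  \<comment> \<open>A bounded set has finite measure, the whole space infinite measure.\<close>
  have "\<not> (AE x in lborel. x \<in> \<Omega>)"
  proof
    assume "AE x in lborel. x \<in> \<Omega>"
    then have "emeasure lborel \<Omega> = emeasure lborel (UNIV :: 'a set)"
      using \<Omega>(2) by (intro emeasure_eq_AE) auto
    then show False
      using emeasure_bounded_finite[OF \<Omega>(1)] by simp
  qed
  \<comment> \<open>By Fubini, for almost every \<open>x\<close> the function equals
    \<open>f x\<close> almost everywhere. If that value were nonzero, almost every point would lie
    in \<open>\<Omega>\<close>.\<close>
  moreover have "AE y in lborel. y \<in> \<Omega>" if "f x \<noteq> 0" "AE y in lborel. f x = f y" for x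
    using that(2) supp by eventually_elim (use that(1) in auto)
  moreover have "AE x in lborel. AE y in lborel. f x = f y"
    using lborel_pair.AE_pair[OF eq] by simp
  ultimately show ?thesis
    by (auto elim: eventually_mono)
qed

text \<open>The part of \<open>\<Omega>\<close> where \<open>f\<close> exceeds \<open>g\<close> is
  open and null, and a nonempty open set is not negligible.\<close>

lemma continuous_on_AE_le_imp_le:
  fixes f g :: "'a::euclidean_space \<Rightarrow> real"
  assumes "open \<Omega>" "continuous_on \<Omega> f" "continuous_on \<Omega> g"
    and "AE x in lborel. x \<in> \<Omega> \<longrightarrow> f x \<le> g x"
  shows "\<forall>x\<in>\<Omega>. f x \<le> g x"
proof -
  define S where "S = \<Omega> \<inter> (\<lambda>x. f x - g x) -` {0<..}"
  have "open S"
    unfolding S_def using assms by (intro continuous_open_preimage continuous_intros) auto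
  have "AE x in lborel. x \<notin> S"
    using assms(4) by eventually_elim (auto simp: S_def)
  then have "negligible S"
    using \<open>open S\<close> AE_iff_null_sets[of S lborel]
    by (auto simp: negligible_iff_null_sets intro: null_sets_completionI)
  then show ?thesis
    using open_not_negligible[OF \<open>open S\<close>] by (force simp: S_def)
qed

section \<open>Comparison of solutions with ordered data\<close>

lemma singular_term_integrable:
  fixes \<Omega> :: "'a::euclidean_space set"
  assumes \<Omega>: "bounded \<Omega>" "\<Omega> \<in> sets lborel"
    and \<omega>: "set_integrable lborel \<Omega> \<omega>" "AE x in lborel. x \<in> \<Omega> \<longrightarrow> 0 \<le> \<omega> x"
    and u[measurable]: "u \<in> borel_measurable lborel" and u0: "AE x in lborel. x \<in> \<Omega> \<longrightarrow> 0 < u x"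
    and \<phi>: "\<phi> \<in> W0 s p \<Omega>" and "1 < p" "0 < \<alpha>" "0 < m" "0 < \<epsilon>"
  shows "set_integrable lborel \<Omega> (\<lambda>x. min (\<omega> x) m * \<phi> x / (u x + \<epsilon>) powr \<alpha>)"
proof -
  note [measurable] = \<Omega>(2)
  have [measurable]: "\<phi> \<in> borel_measurable lborel" using \<phi> by (simp add: W0_iff)
  have [measurable]: "(\<lambda>x. indicator \<Omega> x * \<omega> x) \<in> borel_measurable lborel"
    using \<omega>(1) by (simp add: set_integrable_def integrable_iff_bounded)
  \<comment> \<open>Measurability of \<open>\<omega>\<close> is known only after multiplication by
    the indicator of \<open>\<Omega>\<close>. Under the outer indicator this change has no
    effect.\<close>
  have eq: "(\<lambda>x. indicator \<Omega> x *\<^sub>R (min (\<omega> x) m * \<phi> x / (u x + \<epsilon>) powr \<alpha>)) =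
    (\<lambda>x. indicator \<Omega> x * (min (indicator \<Omega> x * \<omega> x) m * \<phi> x / (u x + \<epsilon>) powr \<alpha>))"
    by (auto simp: indicator_def)
  show ?thesis
    unfolding set_integrable_def
  proof (rule Bochner_Integration.integrable_bound)
    \<comment> \<open>The dominating function comes from three bounds on \<open>\<Omega>\<close>:
      the truncated weight is at most \<open>m\<close>, the denominator is at least
      \<open>\<epsilon> powr \<alpha>\<close>, and \<open>|\<phi>| \<le> 1 + |\<phi>| powr p\<close>
      because \<open>1 < p\<close>. The constant 1 is integrable over a bounded set.\<close>
    have "integrable lborel (indicat_real \<Omega>)"
      using \<Omega> emeasure_bounded_finite by (intro integrable_real_indicator) auto
    then show "integrable lborel (\<lambda>x. m / \<epsilon> powr \<alpha> * (indicator \<Omega> x + \<bar>\<phi> x\<bar> powr p))"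
      using \<phi> by (auto simp: W0_iff)
    show "(\<lambda>x. indicator \<Omega> x *\<^sub>R (min (\<omega> x) m * \<phi> x / (u x + \<epsilon>) powr \<alpha>)) \<in> borel_measurable lborel"
      unfolding eq by measurable
    show "AE x in lborel. norm (indicator \<Omega> x *\<^sub>R (min (\<omega> x) m * \<phi> x / (u x + \<epsilon>) powr \<alpha>))
        \<le> norm (m / \<epsilon> powr \<alpha> * (indicator \<Omega> x + \<bar>\<phi> x\<bar> powr p))"
      using \<omega>(2) u0
    proof eventually_elim
      case (elim x)
      show ?case
      proof (cases "x \<in> \<Omega>")
        case True
        then have x: "0 \<le> \<omega> x" "0 < u x" using elim by auto
        have "\<bar>\<phi> x\<bar> \<le> 1 + \<bar>\<phi> x\<bar> powr p"
        proof (cases "\<bar>\<phi> x\<bar> \<le> 1")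
          case False
          then show ?thesis using powr_mono[of 1 p "\<bar>\<phi> x\<bar>"] \<open>1 < p\<close> by simp
        qed (simp add: add_increasing2)
        moreover have "\<epsilon> powr \<alpha> \<le> (u x + \<epsilon>) powr \<alpha>"
          using x assms by (intro powr_mono2) auto
        ultimately have "min (\<omega> x) m * \<bar>\<phi> x\<bar> / (u x + \<epsilon>) powr \<alpha>
            \<le> m * (1 + \<bar>\<phi> x\<bar> powr p) / \<epsilon> powr \<alpha>"
          using x assms by (intro frac_le mult_mono) auto
        then show ?thesis using True x assms by (simp add: abs_mult)
      qed simp
    qed
  qed
qed

text \<open>At equal values of the solution, a lower truncation level and a larger shift both make
  the source term smaller. Testing with the positive part of \<open>u - v\<close> turns this into an
  order of the solutions.\<close>

lemma weak_comparison:
  fixes \<Omega> :: "'a::euclidean_space set"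
  assumes \<Omega>: "bounded \<Omega>" "\<Omega> \<in> sets lborel" and "1 < p" "0 < \<alpha>"
    and \<omega>: "set_integrable lborel \<Omega> \<omega>" "AE x in lborel. x \<in> \<Omega> \<longrightarrow> 0 \<le> \<omega> x"
    and mk: "0 < m" "m \<le> k" and \<epsilon>: "0 < \<delta>" "\<delta> \<le> \<epsilon>"
    and u: "u \<in> W0 s p \<Omega>" "AE x in lborel. x \<in> \<Omega> \<longrightarrow> 0 < u x"
      "\<And>\<phi>. \<phi> \<in> W0 s p \<Omega> \<Longrightarrow> frac_p_laplace_pairing s p u \<phi>
         = (LINT x:\<Omega>|lborel. min (\<omega> x) m * \<phi> x / (u x + \<epsilon>) powr \<alpha>)"
    and v: "v \<in> W0 s p \<Omega>" "AE x in lborel. x \<in> \<Omega> \<longrightarrow> 0 < v x"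
      "\<And>\<phi>. \<phi> \<in> W0 s p \<Omega> \<Longrightarrow> frac_p_laplace_pairing s p v \<phi>
         = (LINT x:\<Omega>|lborel. min (\<omega> x) k * \<phi> x / (v x + \<delta>) powr \<alpha>)"
  shows "AE x in lborel. x \<in> \<Omega> \<longrightarrow> u x \<le> v x"
proof -
  define \<phi> where "\<phi> = (\<lambda>x. max 0 (u x - v x))"
  have [measurable]: "u \<in> borel_measurable lborel" "v \<in> borel_measurable lborel"
    using u(1) v(1) by (auto simp: W0_iff)
  have \<phi>: "\<phi> \<in> W0 s p \<Omega>"
    using \<open>1 < p\<close> by (intro W0_dominated[OF u(1) v(1)]) (auto simp: \<phi>_def)
  define D where "D = (\<lambda>z. pairing_density s p u \<phi> z - pairing_density s p v \<phi> z)"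
  \<comment> \<open>This is the form of \<open>signed_powr_pos_part_monotone\<close>, with
    \<open>a\<close>, \<open>b\<close> the values of \<open>u\<close> and \<open>c\<close>,
    \<open>d\<close> those of \<open>v\<close> at the two points.\<close>
  have D_eq: "D z = (signed_powr p (u (fst z) - u (snd z)) - signed_powr p (v (fst z) - v (snd z)))
      * (\<phi> (fst z) - \<phi> (snd z)) / norm (fst z - snd z) powr (real DIM('a) + s * p)" for z
    by (simp add: D_def pairing_density_def algebra_simps flip: diff_divide_distrib)
  have D_int: "integrable (lborel \<Otimes>\<^sub>M lborel) D"
    unfolding D_def using u v \<phi> \<open>1 < p\<close> by (intro Bochner_Integration.integrable_diff pairing_density_integrable)
  have D_nonneg: "0 \<le> D z" for z
    unfolding D_eq \<phi>_def by (intro divide_nonneg_nonneg signed_powr_pos_part_monotone(1) \<open>1 < p\<close>) auto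
  have "integral\<^sup>L (lborel \<Otimes>\<^sub>M lborel) D = frac_p_laplace_pairing s p u \<phi> - frac_p_laplace_pairing s p v \<phi>"
    unfolding D_def frac_p_laplace_pairing_alt
    using u v \<phi> \<open>1 < p\<close> by (intro Bochner_Integration.integral_diff pairing_density_integrable)
  also have "\<dots> \<le> 0"
  proof -
    have "(LINT x:\<Omega>|lborel. min (\<omega> x) m * \<phi> x / (u x + \<epsilon>) powr \<alpha>)
        \<le> (LINT x:\<Omega>|lborel. min (\<omega> x) k * \<phi> x / (v x + \<delta>) powr \<alpha>)"
    proof (rule set_integral_mono_AE)
      show "AE x\<in>\<Omega> in lborel. min (\<omega> x) m * \<phi> x / (u x + \<epsilon>) powr \<alpha>
          \<le> min (\<omega> x) k * \<phi> x / (v x + \<delta>) powr \<alpha>"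
        using \<omega>(2) v(2)
      proof eventually_elim
        case (elim x)
        show ?case
        proof (intro impI)
          assume "x \<in> \<Omega>"
          then have x: "0 \<le> \<omega> x" "0 < v x" using elim by auto
          show "min (\<omega> x) m * \<phi> x / (u x + \<epsilon>) powr \<alpha> \<le> min (\<omega> x) k * \<phi> x / (v x + \<delta>) powr \<alpha>"
          \<comment> \<open>Where \<open>u x \<le> v x\<close> the test function is 0 and both sides
            vanish; elsewhere numerators and denominators are ordered the right way.\<close>
          proof (cases "u x \<le> v x")
            case False
            then have "(v x + \<delta>) powr \<alpha> \<le> (u x + \<epsilon>) powr \<alpha>"
              using x \<epsilon> \<open>0 < \<alpha>\<close> by (intro powr_mono2) auto
            then show ?thesis
              using x \<epsilon> mk by (intro frac_le mult_mono) (auto simp: \<phi>_def)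
          qed (simp add: \<phi>_def)
        qed
      qed
    qed (use assms \<phi> in \<open>auto intro!: singular_term_integrable\<close>)
    then show ?thesis using u(3) v(3) \<phi> by simp
  qed
  finally have "integral\<^sup>L (lborel \<Otimes>\<^sub>M lborel) D \<le> 0" .
  then have "integral\<^sup>L (lborel \<Otimes>\<^sub>M lborel) D = 0"
    using D_nonneg by (intro antisym integral_nonneg_AE) auto
  then have "AE z in lborel \<Otimes>\<^sub>M lborel. D z = 0"
    using integral_nonneg_eq_0_iff_AE[OF D_int] D_nonneg by simp
  then have "AE z in lborel \<Otimes>\<^sub>M lborel. \<phi> (fst z) = \<phi> (snd z)"
  proof eventually_elim
    case (elim z)
    show ?case
    \<comment> \<open>On the diagonal \<open>D z = 0\<close> holds by division by zero and says
      nothing, but there the claim is trivial. Off it the kernel denominator is positive, so the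
      numerator must vanish.\<close>
    proof (cases "fst z = snd z")
      case False
      then show ?thesis
        using elim signed_powr_pos_part_monotone(2)[OF \<open>1 < p\<close>] unfolding D_eq \<phi>_def by simp
    qed simp
  qed
  then have "AE x in lborel. \<phi> x = 0"
    using \<Omega> \<phi> by (intro AE_const_zero_of_bounded_support[of \<phi> \<Omega>]) (auto simp: W0_iff)
  then show ?thesis
    by eventually_elim (auto simp: \<phi>_def max_def split: if_splits)
qed

section \<open>Order and positivity of the seminorms\<close>

lemma frac_p_laplace_pairing_self_mono:
  assumes "1 < p" "u \<in> W0 s p \<Omega>" "v \<in> W0 s p \<Omega>"
    and "0 \<le> frac_p_laplace_pairing s p u (\<lambda>x. v x - u x)"
  shows "frac_p_laplace_pairing s p u u \<le> frac_p_laplace_pairing s p v v"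
proof -
  have "frac_p_laplace_pairing s p u u \<le> frac_p_laplace_pairing s p u v"
    using assms frac_p_laplace_pairing_diff[of u s p \<Omega> v u] by simp
  also have "\<dots> \<le> (1 - 1 / p) * frac_p_laplace_pairing s p u u + frac_p_laplace_pairing s p v v / p"
    using assms by (intro frac_p_laplace_pairing_young)
  \<comment> \<open>Absorbing the \<open>u\<close> term on the left leaves both self-pairings with
    the positive factor \<open>1 / p\<close>.\<close>
  finally show ?thesis
    using \<open>1 < p\<close> by (simp add: field_simps)
qed

text \<open>Zero energy makes \<open>u\<close> constant almost everywhere, hence zero by its bounded
  support, against positivity on a nonempty open set.\<close>

lemma gagliardo_pos:
  fixes \<Omega> :: "'a::euclidean_space set"
  assumes "open \<Omega>" "bounded \<Omega>" "\<Omega> \<noteq> {}" "u \<in> W0 s p \<Omega>"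
    and pos: "AE x in lborel. x \<in> \<Omega> \<longrightarrow> 0 < u x"
  shows "0 < gagliardo s p u"
proof (rule ccontr)
  assume "\<not> 0 < gagliardo s p u"
  then have "frac_p_laplace_pairing s p u u = 0"
    using frac_p_laplace_pairing_self_nonneg[of s p u] unfolding gagliardo_W0[OF assms(4)]
    by simp
  then have "AE z in lborel \<Otimes>\<^sub>M lborel. gagliardo_density s p u z = 0"
    using assms(4) unfolding frac_p_laplace_pairing_alt pairing_density_self
    by (subst (asm) integral_nonneg_eq_0_iff_AE) (auto simp: W0_iff gagliardo_density_nonneg)
  then have "AE z in lborel \<Otimes>\<^sub>M lborel. u (fst z) = u (snd z)"
    by eventually_elim (auto simp: gagliardo_density_def)
  then have "AE x in lborel. u x = 0"
    using assms by (intro AE_const_zero_of_bounded_support[of u \<Omega>]) (auto simp: W0_iff)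
  \<comment> \<open>The contradiction is phrased as a false inequality between constant functions,
    so that the continuity lemma yields it at every point of \<open>\<Omega>\<close>.\<close>
  with pos have "AE x in lborel. x \<in> \<Omega> \<longrightarrow> (1::real) \<le> 0"
    by eventually_elim auto
  then have "\<forall>x\<in>\<Omega>. (1::real) \<le> 0"
    using \<open>open \<Omega>\<close> by (intro continuous_on_AE_le_imp_le) auto
  then show False using \<open>\<Omega> \<noteq> {}\<close> by auto
qed

section \<open>Application to the sequence \<open>u n\<close>\<close>

theorem proposition2p4p3:
  fixes \<Omega> :: "'a::euclidean_space set"
    and s p \<alpha> :: real
    and \<omega> :: "'a \<Rightarrow> real"
    and u :: "nat \<Rightarrow> 'a \<Rightarrow> real"
  assumes "DIM('a) \<ge> 2"
    and "bounded_smooth_domain \<Omega>"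
    and "0 < s" "s < 1" "1 < p" "0 < \<alpha>"
    and "set_integrable lborel \<Omega> \<omega>"
    and "AE x in lborel. x \<in> \<Omega> \<longrightarrow> 0 \<le> \<omega> x"
    and "\<not> (AE x in lborel. x \<in> \<Omega> \<longrightarrow> \<omega> x = 0)"
    and "\<And>n. n \<ge> 1 \<Longrightarrow> u n \<in> W0 s p \<Omega>"
    and "\<And>n. n \<ge> 1 \<Longrightarrow> AE x in lborel. x \<in> \<Omega> \<longrightarrow> 0 < u n x"
    and "\<And>n \<phi>. n \<ge> 1 \<Longrightarrow> \<phi> \<in> W0 s p \<Omega> \<Longrightarrow>
           frac_p_laplace_pairing s p (u n) \<phi> =
             (LINT x:\<Omega>|lborel. min (\<omega> x) (real n) * \<phi> x / (u n x + 1 / real n) powr \<alpha>)"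
  shows "(\<forall>n\<ge>1. AE x in lborel. x \<in> \<Omega> \<longrightarrow> u n x \<le> u (n + 1) x) \<and>
         (\<forall>n\<ge>1. continuous_on \<Omega> (u n) \<longrightarrow> continuous_on \<Omega> (u (n + 1)) \<longrightarrow>
            (\<forall>x\<in>\<Omega>. u n x \<le> u (n + 1) x)) \<and>
         (\<forall>n\<ge>1. 0 < gagliardo s p (u n) \<and> gagliardo s p (u n) < \<infinity>) \<and>
         (\<forall>n\<ge>1. gagliardo s p (u n) \<le> gagliardo s p (u (n + 1)))"
proof -
  have \<Omega>: "open \<Omega>" "bounded \<Omega>" "\<Omega> \<noteq> {}" "\<Omega> \<in> sets lborel"
    using assms(2) by (auto simp: bounded_smooth_domain_def)
  note W = assms(10) and pos = assms(11) and eqn = assms(12)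
  \<comment> \<open>The comparison is used with levels \<open>n\<close>, \<open>n + 1\<close> and
    shifts \<open>1 / n\<close>, \<open>1 / (n + 1)\<close>; all of them are positive because
    \<open>n \<ge> 1\<close>.\<close>
  have mono: "AE x in lborel. x \<in> \<Omega> \<longrightarrow> u n x \<le> u (n + 1) x" if "n \<ge> 1" for n
    using that by (intro weak_comparison[OF \<Omega>(2,4) assms(5,6,7,8) _ _ _ _ W pos eqn W pos eqn])
      (auto simp: frac_le)
  have "gagliardo s p (u n) \<le> gagliardo s p (u (n + 1))" if n: "n \<ge> 1" for n
  proof -
    let ?\<phi> = "\<lambda>x. u (n + 1) x - u n x"
    have "u n \<in> borel_measurable lborel" "u (n + 1) \<in> borel_measurable lborel"
      using W[of n] W[of "n + 1"] n by (auto simp: W0_iff)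
    then have "?\<phi> \<in> borel_measurable lborel"
      by (rule borel_measurable_diff[rotated])
    then have "?\<phi> \<in> W0 s p \<Omega>"
      using assms(5) n by (intro W0_dominated[OF W[of n] W[of "n + 1"]]) auto
    then have "frac_p_laplace_pairing s p (u n) ?\<phi>
        = (LINT x:\<Omega>|lborel. min (\<omega> x) (real n) * ?\<phi> x / (u n x + 1 / real n) powr \<alpha>)"
      using eqn n by blast
    \<comment> \<open>The weight is nonnegative, and so is the test function on
      \<open>\<Omega>\<close>, by the order just proved.\<close>
    also have "\<dots> \<ge> 0"
      unfolding set_lebesgue_integral_def
    proof (rule integral_nonneg_AE)
      show "AE x in lborel. 0 \<le> indicator \<Omega> x *\<^sub>R
          (min (\<omega> x) (real n) * ?\<phi> x / (u n x + 1 / real n) powr \<alpha>)"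
        using assms(8) mono[OF n] by eventually_elim (auto simp: indicator_def)
    qed
    finally have "frac_p_laplace_pairing s p (u n) (u n)
        \<le> frac_p_laplace_pairing s p (u (n + 1)) (u (n + 1))"
      using assms(5) n by (intro frac_p_laplace_pairing_self_mono[OF _ W W]) auto
    then have "frac_p_laplace_pairing s p (u n) (u n) powr (1 / p)
        \<le> frac_p_laplace_pairing s p (u (n + 1)) (u (n + 1)) powr (1 / p)"
      using assms(5) by (intro powr_mono2 frac_p_laplace_pairing_self_nonneg) auto
    then show ?thesis
      using n by (simp add: gagliardo_W0[OF W])
  qed
  moreover have "0 < gagliardo s p (u n) \<and> gagliardo s p (u n) < \<infinity>" if "n \<ge> 1" for n
    using gagliardo_pos[OF \<Omega>(1-3) W pos] W[OF that] that by (auto simp: W0_def)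
  ultimately show ?thesis
    using mono continuous_on_AE_le_imp_le[OF \<Omega>(1)] by blast
qed

end
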